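(* For every $n\geq 7$ there is a totally chiral hypermap whose monodromy group is isomorphic to the alternating group $A_n$.
   Context: Let $\Delta=\langle r_0,r_1,r_2\mid r_0^2=r_1^2=r_2^2=1\rangle$ and let $\Delta^+$ be its index-$2$ subgroup of even-length words, generated by $\rho=r_1r_2$ and $\lambda=r_2r_0$. An (oriented) hypermap is a triple $\mathcal H=(D,R,L)$ with $D$ a finite set and $R,L$ permutations of $D$ such that the monodromy group $\mathrm{Mon}(\mathcal H)=\langle R,L\rangle$ is transitive on $D$. It is orientably regular if its automorphism group (permutations of $D$ commuting with $R$ and $L$) acts regularly on $D$; then $\mathcal H\cong(\Delta^+/H,\rho,\lambda)$ (left multiplication on cosets) for a unique normal subgroup $H$ of finite index in $\Delta^+$ (the hypermap subgroup), and $\mathrm{Mon}(\mathcal H)\cong\Delta^+/H$. For $H\trianglelefteq\Delta^+$ put $H^r=r_2Hr_2$. An orientably regular hypermap is totally chiral if $HH^r=\Delta^+$, i.e. its chirality group $HH^r/H$ equals its whole monodromy group $\Delta^+/H$. *)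

theory Defs
  imports "HOL-Algebra.Algebra"
begin

section \<open>The group \<Delta> and its even subgroup\<close>

datatype gen = r0 | r1 | r2

text \<open>
  The group presented by the generators and the relations r_i^2 = 1. As every generator is its own
  inverse, the words in the generators (without formal inverses) modulo the congruence
  generated by r_i r_i = 1 already form this group. The relation \<^term>\<open>cancel\<close> is closed
  under left and right contexts, so its equivalence closure is that congruence.
\<close>

inductive cancel :: "gen list \<Rightarrow> gen list \<Rightarrow> bool" where
  "cancel (u @ [x, x] @ v) (u @ v)"

definition word_rel :: "(gen list \<times> gen list) set" where
  "word_rel = {(u, v). equivclp cancel u v}"

definition word_class :: "gen list \<Rightarrow> gen list set" where
  "word_class w = word_rel `` {w}"

definition Delta :: "gen list set monoid" where
  "Delta = \<lparr>carrier = UNIV // word_rel,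
            monoid.mult = (\<lambda>A B. \<Union>u\<in>A. \<Union>v\<in>B. word_class (u @ v)),
            one = word_class []\<rparr>"

definition Delta_plus :: "gen list set monoid" where
  "Delta_plus = Delta\<lparr>carrier := {word_class w |w. even (length w)}\<rparr>"

definition rho :: "gen list set" where "rho = word_class [r1, r2]"

definition lam :: "gen list set" where "lam = word_class [r2, r0]"

lemma equivclp_cancel_append:
  assumes "equivclp cancel u u'" shows "equivclp cancel (p @ u @ q) (p @ u' @ q)"
  using assms
proof (induction rule: equivclp_induct)
  case base then show ?case by simp
next
  case (step y z)
  have "cancel (p @ a @ q) (p @ b @ q)" if "cancel a b" for a b
    using that
  proof cases
    case (1 s x t)
    then show ?thesis using cancel.intros[of "p @ s" x "t @ q"] by simp
  qed
  then have "equivclp cancel (p @ y @ q) (p @ z @ q)"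
    using step(2) by blast
  with step(3) show ?case by (rule equivclp_trans)
qed

lemma equiv_word_rel: "equiv UNIV word_rel"
proof -
  have "sym word_rel" by (rule symI) (simp add: word_rel_def equivclp_sym)
  moreover have "trans word_rel"
    by (rule transI) (simp add: word_rel_def, rule equivclp_trans)
  ultimately show ?thesis by (simp add: equiv_def refl_on_def word_rel_def)
qed

lemma word_class_eq_iff: "word_class u = word_class v \<longleftrightarrow> equivclp cancel u v"
  unfolding word_class_def using eq_equiv_class_iff[OF equiv_word_rel, of u v]
  by (simp add: word_rel_def)

lemma word_class_self: "w \<in> word_class w"
  by (simp add: word_class_def word_rel_def)

lemma carrier_Delta: "carrier Delta = range word_class"
  by (auto simp: Delta_def quotient_def word_class_def)

lemma one_Delta: "\<one>\<^bsub>Delta\<^esub> = word_class []"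
  by (simp add: Delta_def)

lemma mult_Delta: "word_class u \<otimes>\<^bsub>Delta\<^esub> word_class v = word_class (u @ v)"
proof -
  have "word_class (a @ b) = word_class (u @ v)" if "a \<in> word_class u" "b \<in> word_class v" for a b
  proof -
    have "equivclp cancel u a" "equivclp cancel v b"
      using that by (auto simp: word_class_def word_rel_def)
    then have "equivclp cancel (u @ v) (a @ v)" "equivclp cancel (a @ v) (a @ b)"
      using equivclp_cancel_append[of u a "[]" v] equivclp_cancel_append[of v b a "[]"] by auto
    then show ?thesis by (metis word_class_eq_iff)
  qed
  then have "(\<Union>a\<in>word_class u. \<Union>b\<in>word_class v. word_class (a @ b)) = word_class (u @ v)"
    using word_class_self[of u] word_class_self[of v] by blast
  then show ?thesis by (simp add: Delta_def)
qed

lemma word_class_cancel: "word_class (u @ x # x # v) = word_class (u @ v)"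
  using cancel.intros[of u x v] by (auto simp: word_class_eq_iff)

lemma word_class_rev: "word_class (rev w @ w) = word_class []"
proof (induction w)
  case (Cons a w)
  then show ?case using word_class_cancel[of "rev w" a w] by simp
qed simp

lemma group_Delta: "group Delta"
proof (rule groupI)
  fix x assume "x \<in> carrier Delta"
  then obtain w where "x = word_class w" by (auto simp: carrier_Delta)
  then show "\<exists>y\<in>carrier Delta. y \<otimes>\<^bsub>Delta\<^esub> x = \<one>\<^bsub>Delta\<^esub>"
    using word_class_rev[of w] by (auto simp: carrier_Delta mult_Delta one_Delta)
qed (auto simp: carrier_Delta mult_Delta one_Delta)

lemma even_length_cong:
  assumes "equivclp cancel u v" shows "even (length u) \<longleftrightarrow> even (length v)"
  using assms by (induction rule: equivclp_induct) (auto elim!: cancel.cases)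

lemma word_class_in_Delta_plus_iff: "word_class w \<in> carrier Delta_plus \<longleftrightarrow> even (length w)"
proof
  assume "word_class w \<in> carrier Delta_plus"
  then obtain v where "word_class w = word_class v" "even (length v)"
    by (auto simp: Delta_plus_def)
  then show "even (length w)" by (simp add: word_class_eq_iff even_length_cong)
qed (auto simp: Delta_plus_def)

lemma inv_Delta: "inv\<^bsub>Delta\<^esub> (word_class w) = word_class (rev w)"
  by (rule group.inv_equality[OF group_Delta])
    (auto simp: mult_Delta one_Delta carrier_Delta word_class_rev)

lemma subgroup_Delta_plus: "subgroup (carrier Delta_plus) Delta"
proof (rule group.subgroupI[OF group_Delta])
  show "carrier Delta_plus \<subseteq> carrier Delta" by (auto simp: Delta_plus_def carrier_Delta)
  show "carrier Delta_plus \<noteq> {}" using word_class_in_Delta_plus_iff[of "[]"] by auto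
next
  fix a assume "a \<in> carrier Delta_plus"
  then obtain u where "a = word_class u" "even (length u)" by (auto simp: Delta_plus_def)
  then show "inv\<^bsub>Delta\<^esub> a \<in> carrier Delta_plus"
    by (simp add: inv_Delta word_class_in_Delta_plus_iff)
next
  fix a b assume "a \<in> carrier Delta_plus" "b \<in> carrier Delta_plus"
  then obtain u v where "a = word_class u" "even (length u)" "b = word_class v" "even (length v)"
    by (auto simp: Delta_plus_def)
  then show "a \<otimes>\<^bsub>Delta\<^esub> b \<in> carrier Delta_plus"
    by (simp add: mult_Delta word_class_in_Delta_plus_iff)
qed

lemma Delta_plus_generated: "carrier Delta_plus = generate Delta {rho, lam}"
proof
  interpret group Delta by (rule group_Delta)
  have sub: "{rho, lam} \<subseteq> carrier Delta_plus"
    by (simp add: rho_def lam_def word_class_in_Delta_plus_iff)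
  then show "generate Delta {rho, lam} \<subseteq> carrier Delta_plus"
    by (rule generate_subgroup_incl[OF _ subgroup_Delta_plus])
  let ?G = "generate Delta {rho, lam}"
  have sg: "subgroup ?G Delta"
    using sub subgroup.subset[OF subgroup_Delta_plus] by (intro generate_is_subgroup) auto
  have rho: "rho \<in> ?G" and lam: "lam \<in> ?G" by (auto intro: generate.incl)
  have irho: "word_class [r2, r1] \<in> ?G" and ilam: "word_class [r0, r2] \<in> ?G"
    using subgroup.m_inv_closed[OF sg rho] subgroup.m_inv_closed[OF sg lam]
    by (auto simp: rho_def lam_def inv_Delta)
  have r10: "word_class [r1, r0] \<in> ?G"
    using subgroup.m_closed[OF sg rho lam] word_class_cancel[of "[r1]" r2 "[r0]"]
    by (simp add: rho_def lam_def mult_Delta)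
  have r01: "word_class [r0, r1] \<in> ?G"
    using subgroup.m_inv_closed[OF sg r10] by (simp add: inv_Delta)
  have rr: "word_class [x, x] \<in> ?G" for x
    using subgroup.one_closed[OF sg] word_class_cancel[of "[]" x "[]"] by (simp add: one_Delta)
  have two: "word_class [x, y] \<in> ?G" for x y
    using rho lam irho ilam r10 r01 rr by (cases x; cases y) (auto simp: rho_def lam_def)
  have "word_class w \<in> ?G" if "even (length w)" for w
    using that
  proof (induction w rule: length_induct)
    case (1 w)
    show ?case
    proof (cases w)
      case Nil then show ?thesis using subgroup.one_closed[OF sg] by (simp add: one_Delta)
    next
      case (Cons x w')
      then obtain y v where w: "w = x # y # v" using 1(2) by (cases w') auto
      then have "word_class v \<in> ?G" using 1 by auto
      from subgroup.m_closed[OF sg two[of x y] this] show ?thesis by (simp add: mult_Delta w)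
    qed
  qed
  then show "carrier Delta_plus \<subseteq> ?G" by (auto simp: Delta_plus_def)
qed

section \<open>Oriented hypermaps\<close>

record 'd hypermap =
  darts :: "'d set"
  hm_R :: "'d \<Rightarrow> 'd"
  hm_L :: "'d \<Rightarrow> 'd"

definition monodromy_group :: "'d hypermap \<Rightarrow> ('d \<Rightarrow> 'd) monoid" where
  "monodromy_group M = subgroup_generated (BijGroup (darts M)) {hm_R M, hm_L M}"

definition is_hypermap :: "'d hypermap \<Rightarrow> bool" where
  "is_hypermap M \<longleftrightarrow>
     finite (darts M) \<and> darts M \<noteq> {} \<and> hm_R M \<in> Bij (darts M) \<and> hm_L M \<in> Bij (darts M) \<and>
     (\<forall>x\<in>darts M. \<forall>y\<in>darts M. \<exists>g\<in>carrier (monodromy_group M). g x = y)"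

definition hypermap_iso :: "'d hypermap \<Rightarrow> 'e hypermap \<Rightarrow> bool" where
  "hypermap_iso M N \<longleftrightarrow>
     (\<exists>f. bij_betw f (darts M) (darts N) \<and>
       (\<forall>d\<in>darts M. f (hm_R M d) = hm_R N (f d) \<and> f (hm_L M d) = hm_L N (f d)))"

definition hypermap_automorphisms :: "'d hypermap \<Rightarrow> ('d \<Rightarrow> 'd) set" where
  "hypermap_automorphisms M =
     {f \<in> Bij (darts M). \<forall>d\<in>darts M. f (hm_R M d) = hm_R M (f d) \<and> f (hm_L M d) = hm_L M (f d)}"

definition orientably_regular :: "'d hypermap \<Rightarrow> bool" where
  "orientably_regular M \<longleftrightarrow>
     is_hypermap M \<and>
     (\<forall>x\<in>darts M. \<forall>y\<in>darts M. \<exists>!f. f \<in> hypermap_automorphisms M \<and> f x = y)"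

definition coset_hypermap :: "gen list set set \<Rightarrow> gen list set set hypermap" where
  "coset_hypermap H =
     \<lparr>darts = lcosets\<^bsub>Delta_plus\<^esub> H,
      hm_R = (\<lambda>C \<in> lcosets\<^bsub>Delta_plus\<^esub> H. rho <#\<^bsub>Delta_plus\<^esub> C),
      hm_L = (\<lambda>C \<in> lcosets\<^bsub>Delta_plus\<^esub> H. lam <#\<^bsub>Delta_plus\<^esub> C)\<rparr>"

definition is_hypermap_subgroup :: "'d hypermap \<Rightarrow> gen list set set \<Rightarrow> bool" where
  "is_hypermap_subgroup M H \<longleftrightarrow>
     H \<lhd> Delta_plus \<and> finite (lcosets\<^bsub>Delta_plus\<^esub> H) \<and> hypermap_iso M (coset_hypermap H)"

definition reflect :: "gen list set set \<Rightarrow> gen list set set" where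
  "reflect H = (\<lambda>h. word_class [r2] \<otimes>\<^bsub>Delta\<^esub> h \<otimes>\<^bsub>Delta\<^esub> word_class [r2]) ` H"

text \<open>
  The hypermap subgroup of an orientably regular hypermap is unique, so it does not matter that
  it is bound here by an existential quantifier.
\<close>

definition totally_chiral :: "'d hypermap \<Rightarrow> bool" where
  "totally_chiral M \<longleftrightarrow>
     orientably_regular M \<and>
     (\<exists>H. is_hypermap_subgroup M H \<and> H <#>\<^bsub>Delta_plus\<^esub> reflect H = carrier Delta_plus)"

end

theory Submission
  imports Defs
begin

text \<open>
  Word evaluation turns a pair \<open>x, y\<close> generating a finite group \<open>G\<close> into an epimorphism
  \<open>\<Delta>\<^sup>+ \<rightarrow> G\<close>, \<open>\<rho> \<mapsto> x\<close>, \<open>\<lambda> \<mapsto> y\<close>, with kernel \<open>H\<close>; the reflected subgroup \<open>H\<^sup>r\<close> is the kernel of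
  \<open>\<rho> \<mapsto> x\<inverse>\<close>, \<open>\<lambda> \<mapsto> y\<inverse>\<close>. Hence \<open>H H\<^sup>r = \<Delta>\<^sup>+\<close> as soon as the subgroup \<open>Q\<close> of \<open>G \<times> G\<close> generated by
  \<open>(x, x\<inverse>)\<close> and \<open>(y, y\<inverse>)\<close> contains \<open>G \<times> 1\<close>, which also forces \<open>x, y\<close> to generate \<open>G\<close>. The hypermap
  is \<open>G\<close> with the left multiplications by \<open>x\<close> and \<open>y\<close>.

  For \<open>A_n\<close> let \<open>m\<close> be the odd one of \<open>n - 1, n\<close>, and let \<open>x = (1 2 ... m)\<close>, \<open>y = t s\<close> with
  \<open>t = (2 3 5)\<close>, \<open>s = (4 6)(1 n)\<close>. The powers \<open>y^4 = t\<close> and \<open>y^3 = s\<close> separate the two factors, so \<open>Q\<close>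
  contains \<open>(t, t\<inverse>)\<close> and \<open>(u, v)\<close> for \<open>u = x s x\<inverse>\<close>, \<open>v = x\<inverse> s x\<close>. As \<open>v t v\<inverse> = t\<inverse>\<close> while \<open>u t u\<inverse>\<close>
  is a 3-cycle meeting the support of \<open>t\<close> in one point, the commutator of \<open>(t, t\<inverse>)\<close> with its
  conjugate under \<open>(u, v)\<close> is \<open>(c, 1)\<close> for a 3-cycle \<open>c\<close>. Conjugating \<open>c\<close> by \<open>x\<close> and \<open>y\<close> then yields
  every 3-cycle.
\<close>

section \<open>Regular hypermaps from generating pairs\<close>

lemma group_Delta_plus: "group Delta_plus"
proof -
  have "Delta_plus = Delta\<lparr>carrier := carrier Delta_plus\<rparr>" by (simp add: Delta_plus_def)
  then show ?thesis using group.subgroup_imp_group[OF group_Delta subgroup_Delta_plus] by simp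
qed

lemma Delta_plus_cases:
  assumes "A \<in> carrier Delta_plus"
  obtains w where "A = word_class w" "even (length w)"
  using assms by (auto simp: Delta_plus_def)

lemma mult_Delta_plus: "a \<otimes>\<^bsub>Delta_plus\<^esub> b = a \<otimes>\<^bsub>Delta\<^esub> b"
  by (simp add: Delta_plus_def)

section \<open>Evaluating even words in a group with two chosen elements\<close>

locale generator_pair = group G for G (structure) +
  fixes x y :: 'a
  assumes x_closed [simp]: "x \<in> carrier G" and y_closed [simp]: "y \<in> carrier G"
begin

text \<open>Chosen to give \<open>rho = r1 r2\<close> the value \<open>x\<close> and
  \<open>lam = r2 r0\<close> the value \<open>y\<close>: in \<open>lam\<close> the letter
  \<open>r0\<close> stands at an inverted place, so it carries \<open>inv y\<close>.\<close>

primrec letter :: "gen \<Rightarrow> 'a" where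
  "letter r0 = inv y" | "letter r1 = x" | "letter r2 = \<one>"

lemma letter_closed [simp]: "letter a \<in> carrier G"
  by (cases a) auto

text \<open>
  Inverting every second letter makes the relations \<open>r_i r_i = 1\<close> hold without forcing
  the letters to be involutions. The flag tells whether the first letter is taken as it is.
\<close>

primrec val :: "gen list \<Rightarrow> bool \<Rightarrow> 'a" where
  "val [] b = \<one>"
| "val (a # w) b = (if b then letter a else inv letter a) \<otimes> val w (\<not> b)"

lemma val_closed [simp]: "val w b \<in> carrier G"
  by (induction w arbitrary: b) auto

text \<open>Inversion depends on the parity of the position, so the flag flips across a prefix of
  odd length. On words of even length \<open>val\<close> is therefore multiplicative.\<close>

lemma val_append: "val (u @ v) b = val u b \<otimes> val v (b = even (length u))"
proof (induction u arbitrary: b)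
  case (Cons a u)
  have "((\<not> b) = even (length u)) = (b = even (length (a # u)))" by auto
  then show ?case using Cons by (simp add: m_assoc)
qed simp

lemma val_cancel:
  assumes "cancel u v" shows "val u b = val v b"
  using assms
proof cases
  case (1 p a q)
  have "val ([a, a] @ q) c = val q c" for c
    by (simp add: m_assoc[symmetric])
  then show ?thesis by (simp only: 1 val_append[of p])
qed

lemma val_cong:
  assumes "equivclp cancel u v" shows "val u b = val v b"
  using assms by (induction rule: equivclp_induct) (metis val_cancel)+

text \<open>Elements of \<open>Delta\<close> are sets of words. The value is read off a chosen
  member, and \<open>val_cong\<close> makes the choice immaterial.\<close>

definition ev :: "bool \<Rightarrow> gen list set \<Rightarrow> 'a" where
  "ev b A = val (SOME w. w \<in> A) b"

lemma ev_word_class [simp]: "ev b (word_class w) = val w b"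
proof -
  have "(SOME v. v \<in> word_class w) \<in> word_class w"
    by (rule someI[of _ w]) (rule word_class_self)
  then have "equivclp cancel w (SOME v. v \<in> word_class w)"
    by (auto simp: word_class_def word_rel_def)
  then show ?thesis by (simp add: ev_def val_cong)
qed

lemma ev_hom: "ev b \<in> hom Delta_plus G"
  by (auto simp: hom_def mult_Delta_plus mult_Delta val_append elim!: Delta_plus_cases)

lemma ev_group_hom: "group_hom Delta_plus G (ev b)"
  by (simp add: group_hom_def group_hom_axioms_def group_Delta_plus ev_hom)

lemma ev_rho: "ev b rho = (if b then x else inv x)"
  and ev_lam: "ev b lam = (if b then y else inv y)"
  by (simp_all add: rho_def lam_def)

lemma rho_closed [simp]: "rho \<in> carrier Delta_plus" and lam_closed [simp]: "lam \<in> carrier Delta_plus"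
  by (simp_all add: rho_def lam_def word_class_in_Delta_plus_iff)

text \<open>The letter \<open>r2\<close> has value \<open>\<one>\<close>, so putting it on both
  sides of an even word changes the value only by flipping the flag.\<close>

lemma reflect_kernel:
  "reflect (kernel Delta_plus G (ev True)) = kernel Delta_plus G (ev False)"
proof -
  let ?r = "\<lambda>h. word_class [r2] \<otimes>\<^bsub>Delta\<^esub> h \<otimes>\<^bsub>Delta\<^esub> word_class [r2]"
  \<comment> \<open>Conjugation by \<open>r2\<close> is an involution swapping the two flags;
    stating this for both values of \<open>b\<close> yields both inclusions.\<close>
  have r: "?r h \<in> kernel Delta_plus G (ev (\<not> b)) \<and> ?r (?r h) = h"
    if "h \<in> kernel Delta_plus G (ev b)" for b h
  proof -
    have "h \<in> carrier Delta_plus" using that by (simp add: kernel_def)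
    then obtain w where w: "h = word_class w" "even (length w)" by (rule Delta_plus_cases)
    have "val w b = \<one>" using that by (simp add: kernel_def w)
    have "word_class (r2 # r2 # w @ [r2, r2]) = word_class w"
      using word_class_cancel[of "[]" r2 "w @ [r2, r2]"] word_class_cancel[of w r2 "[]"] by simp
    then show ?thesis using w \<open>val w b = \<one>\<close>
      by (auto simp: kernel_def mult_Delta val_append word_class_in_Delta_plus_iff)
  qed
  show ?thesis unfolding reflect_def
  proof
    show "?r ` kernel Delta_plus G (ev True) \<subseteq> kernel Delta_plus G (ev False)"
      using r[of _ True] by auto
    show "kernel Delta_plus G (ev False) \<subseteq> ?r ` kernel Delta_plus G (ev True)"
    proof
      fix h assume "h \<in> kernel Delta_plus G (ev False)"
      then show "h \<in> ?r ` kernel Delta_plus G (ev True)"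
        using r[of h False] by (intro image_eqI[of _ _ "?r h"]) auto
    qed
  qed
qed

end

section \<open>The product of the two kernels\<close>

locale chiral_pair = generator_pair +
  assumes finite_carrier: "finite (carrier G)"
    and full: "\<And>c. c \<in> carrier G \<Longrightarrow> (c, \<one>) \<in> generate (G \<times>\<times> G) {(x, inv x), (y, inv y)}"
begin

text \<open>The image of \<open>d \<mapsto> (ev True d, ev False d)\<close> is a subgroup containing
  both generating pairs. With \<open>full\<close>, it follows that \<open>ev True\<close> already
  maps the kernel of \<open>ev False\<close> onto \<open>G\<close>.\<close>

lemma lift:
  assumes "c \<in> carrier G"
  shows "\<exists>d\<in>carrier Delta_plus. ev True d = c \<and> ev False d = \<one>"
proof -
  let ?f = "\<lambda>d. (ev True d, ev False d)"
  interpret P: group "G \<times>\<times> G" by (simp add: DirProd_group is_group)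
  have "?f \<in> hom Delta_plus (G \<times>\<times> G)"
    using ev_hom[of True] ev_hom[of False] by (simp add: hom_pairwise o_def)
  then interpret f: group_hom Delta_plus "G \<times>\<times> G" ?f
    by (simp add: group_hom_def group_hom_axioms_def group_Delta_plus P.is_group)
  have "generate (G \<times>\<times> G) {(x, inv x), (y, inv y)} \<subseteq> ?f ` carrier Delta_plus"
  proof (rule P.generate_subgroup_incl[OF _ f.img_is_subgroup])
    show "{(x, inv x), (y, inv y)} \<subseteq> ?f ` carrier Delta_plus"
      using image_eqI[of "(x, inv x)" ?f rho] image_eqI[of "(y, inv y)" ?f lam]
      by (simp add: ev_rho ev_lam)
  qed
  then obtain d where "d \<in> carrier Delta_plus" "(c, \<one>) = ?f d"
    using full[OF assms] by blast
  then show ?thesis by (intro bexI[of _ d]) auto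
qed

lemma ev_kernel_product:
  "kernel Delta_plus G (ev True) <#>\<^bsub>Delta_plus\<^esub> kernel Delta_plus G (ev False) = carrier Delta_plus"
proof -
  interpret D: group Delta_plus by (rule group_Delta_plus)
  interpret e: group_hom Delta_plus G "ev True" by (rule ev_group_hom)
  show ?thesis
  proof
    show "carrier Delta_plus \<subseteq>
        kernel Delta_plus G (ev True) <#>\<^bsub>Delta_plus\<^esub> kernel Delta_plus G (ev False)"
    proof
      fix g assume g: "g \<in> carrier Delta_plus"
      then obtain d where d: "d \<in> carrier Delta_plus" "ev True d = ev True g" "ev False d = \<one>"
        using lift[of "ev True g"] by auto
      \<comment> \<open>Since \<open>d\<close> has the same \<open>ev True\<close> value as
        \<open>g\<close>, the quotient lies in the first kernel, while \<open>d\<close> itself lies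
        in the second.\<close>
      have "g \<otimes>\<^bsub>Delta_plus\<^esub> inv\<^bsub>Delta_plus\<^esub> d \<in> kernel Delta_plus G (ev True)"
        using g d by (simp add: kernel_def)
      moreover have "g = (g \<otimes>\<^bsub>Delta_plus\<^esub> inv\<^bsub>Delta_plus\<^esub> d) \<otimes>\<^bsub>Delta_plus\<^esub> d"
        using g d by (simp add: D.m_assoc)
      ultimately show "g \<in> kernel Delta_plus G (ev True) <#>\<^bsub>Delta_plus\<^esub> kernel Delta_plus G (ev False)"
        using d unfolding set_mult_def by (auto simp: kernel_def)
    qed
  qed (auto simp: set_mult_def kernel_def)
qed

text \<open>The subgroup generated by the two pairs lies in
  \<open>generate G {x, y} \<times> carrier G\<close>; first coordinates of the pairs in
  \<open>full\<close> give the claim.\<close>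

lemma generate_eq: "generate G {x, y} = carrier G"
proof
  show "generate G {x, y} \<subseteq> carrier G" by (rule generate_incl) auto
  interpret P: group "G \<times>\<times> G" by (simp add: DirProd_group is_group)
  let ?S = "generate G {x, y} \<times> carrier G"
  have "subgroup ?S (G \<times>\<times> G)"
    by (rule DirProd_subgroups) (auto intro: generate_is_subgroup subgroup_self is_group)
  then have "generate (G \<times>\<times> G) {(x, inv x), (y, inv y)} \<subseteq> ?S"
    by (rule P.generate_subgroup_incl[rotated]) (auto intro: generate.incl)
  then show "carrier G \<subseteq> generate G {x, y}" using full by auto
qed

section \<open>The regular representation as a hypermap on numbers\<close>

definition num :: "nat \<Rightarrow> 'a" where
  "num = (SOME e. bij_betw e {..<order G} (carrier G))"

definition code :: "'a \<Rightarrow> nat" where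
  "code = the_inv_into {..<order G} num"

text \<open>Left translation transported along the enumeration \<open>num\<close>, with
  \<open>code\<close> as its inverse. The restriction to the darts makes it extensional, as
  membership in \<open>Bij\<close> demands.\<close>

definition left_mult :: "'a \<Rightarrow> nat \<Rightarrow> nat" where
  "left_mult g = (\<lambda>d\<in>{..<order G}. code (g \<otimes> num d))"

definition regular_hypermap :: "nat hypermap" where
  "regular_hypermap = \<lparr>darts = {..<order G}, hm_R = left_mult x, hm_L = left_mult y\<rparr>"

lemma regular_hypermap_sel [simp]:
  "darts regular_hypermap = {..<order G}"
  "hm_R regular_hypermap = left_mult x" "hm_L regular_hypermap = left_mult y"
  by (simp_all add: regular_hypermap_def)

lemma bij_num: "bij_betw num {..<order G} (carrier G)"
  unfolding num_def order_def
  using someI_ex[OF ex_bij_betw_nat_finite[OF finite_carrier]] by (simp add: atLeast0LessThan)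

lemma num_closed [simp]: "d < order G \<Longrightarrow> num d \<in> carrier G"
  using bij_num by (auto simp: bij_betw_def)

lemma code_less [simp]: "g \<in> carrier G \<Longrightarrow> code g < order G"
  using bij_betw_the_inv_into[OF bij_num] by (auto simp: code_def bij_betw_def)

lemma num_code [simp]: "g \<in> carrier G \<Longrightarrow> num (code g) = g"
  using f_the_inv_into_f_bij_betw[OF bij_num] by (auto simp: code_def)

lemma code_num [simp]: "d < order G \<Longrightarrow> code (num d) = d"
  using the_inv_into_f_f[of num "{..<order G}" d] bij_num by (auto simp: code_def bij_betw_def)

lemma left_mult_apply [simp]: "d < order G \<Longrightarrow> left_mult g d = code (g \<otimes> num d)"
  by (simp add: left_mult_def)

lemma left_mult_Bij:
  assumes "g \<in> carrier G" shows "left_mult g \<in> Bij {..<order G}"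
proof -
  have "bij_betw (left_mult g) {..<order G} {..<order G}"
    by (rule bij_betw_byWitness[of _ "left_mult (inv g)"])
      (use assms in \<open>auto simp: m_assoc[symmetric]\<close>)
  then show ?thesis by (simp add: Bij_def left_mult_def)
qed

lemma left_mult_hom: "left_mult \<in> hom G (BijGroup {..<order G})"
proof (rule homI)
  fix g h assume gh: "g \<in> carrier G" "h \<in> carrier G"
  then have "left_mult (g \<otimes> h) = compose {..<order G} (left_mult g) (left_mult h)"
    by (auto simp: compose_def left_mult_def m_assoc)
  then show "left_mult (g \<otimes> h) = left_mult g \<otimes>\<^bsub>BijGroup {..<order G}\<^esub> left_mult h"
    using gh by (simp add: BijGroup_def left_mult_Bij)
qed (simp add: BijGroup_def left_mult_Bij)

lemma left_mult_inj: "inj_on left_mult (carrier G)"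
proof (rule inj_onI)
  fix g h assume "g \<in> carrier G" "h \<in> carrier G" "left_mult g = left_mult h"
  \<comment> \<open>A left translation is determined by its value at the dart of the
    identity.\<close>
  then have "num (left_mult g (code \<one>)) = num (left_mult h (code \<one>))" by simp
  then show "g = h" using \<open>g \<in> _\<close> \<open>h \<in> _\<close> by simp
qed

lemma carrier_monodromy: "carrier (monodromy_group regular_hypermap) = left_mult ` carrier G"
proof -
  interpret l: group_hom G "BijGroup {..<order G}" left_mult
    by (simp add: group_hom_def group_hom_axioms_def group_BijGroup left_mult_hom)
  have "{left_mult x, left_mult y} = left_mult ` {x, y}" by simp
  then show ?thesis
    using l.generate_img[of "{x, y}"] left_mult_Bij
    by (simp add: monodromy_group_def carrier_subgroup_generated generate_eq BijGroup_def Int_absorb1)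
qed

lemma monodromy_iso: "monodromy_group regular_hypermap \<cong> G"
proof -
  have "left_mult \<in> iso G (monodromy_group regular_hypermap)"
    using left_mult_hom left_mult_inj
    by (auto simp: iso_def hom_def bij_betw_def carrier_monodromy)
      (simp add: monodromy_group_def)
  then show ?thesis using iso_sym is_isoI by blast
qed

lemma is_hypermap: "is_hypermap regular_hypermap"
proof -
  have "\<exists>g\<in>carrier (monodromy_group regular_hypermap). g d = d'"
    if "d < order G" "d' < order G" for d d'
    using that by (auto simp: carrier_monodromy m_assoc intro!: bexI[of _ "num d' \<otimes> inv num d"])
  moreover have "order G > 0" using order_gt_0_iff_finite finite_carrier by simp
  ultimately show ?thesis
    by (auto simp: is_hypermap_def left_mult_Bij)
qed

text \<open>The elements whose translation commutes with \<open>f\<close> form a subgroup. It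
  contains \<open>x\<close> and \<open>y\<close>, which generate \<open>G\<close>.\<close>

lemma automorphism_commutes:
  assumes "f \<in> hypermap_automorphisms regular_hypermap" "g \<in> carrier G" "d < order G"
  shows "f (left_mult g d) = left_mult g (f d)"
proof -
  have f: "f d < order G" if "d < order G" for d
    using assms(1) that by (auto simp: hypermap_automorphisms_def dest!: Bij_imp_funcset)
  let ?S = "{g \<in> carrier G. \<forall>d < order G. f (left_mult g d) = left_mult g (f d)}"
  have mult: "left_mult (g \<otimes> h) d = left_mult g (left_mult h d)"
    if "g \<in> carrier G" "h \<in> carrier G" "d < order G" for g h d
    using that by (simp add: m_assoc)
  have "subgroup ?S G"
  proof (rule subgroupI)
    fix g assume g: "g \<in> ?S"
    have "f (left_mult (inv g) d) = left_mult (inv g) (f d)" if d: "d < order G" for d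
    proof -
      have less: "left_mult (inv g) d < order G" using g d by simp
      have "left_mult g (f (left_mult (inv g) d)) = f (left_mult g (left_mult (inv g) d))"
        using g less by (simp del: left_mult_apply)
      also have "\<dots> = f d" using g d mult[of g "inv g" d] by simp
      finally have "left_mult (inv g) (left_mult g (f (left_mult (inv g) d))) = left_mult (inv g) (f d)"
        by simp
      then show ?thesis
        using g d mult[of "inv g" g "f (left_mult (inv g) d)"] f by simp
    qed
    with g show "inv g \<in> ?S" by auto
  next
    fix g h assume "g \<in> ?S" "h \<in> ?S"
    moreover from this have "f (left_mult (g \<otimes> h) d) = left_mult (g \<otimes> h) (f d)"
      if "d < order G" for d
    proof -
      have "left_mult h d < order G" using \<open>h \<in> ?S\<close> that by simp
      then show ?thesis
        using \<open>g \<in> ?S\<close> \<open>h \<in> ?S\<close> that f by (simp add: mult del: left_mult_apply)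
    qed
    ultimately show "g \<otimes> h \<in> ?S" by simp
  qed (use f in auto)
  moreover have "{x, y} \<subseteq> ?S"
    using assms(1) by (auto simp: hypermap_automorphisms_def)
  ultimately have "generate G {x, y} \<subseteq> ?S" by (rule generate_subgroup_incl[rotated])
  then show ?thesis using assms by (auto simp: generate_eq)
qed

lemma orientably_regular: "orientably_regular regular_hypermap"
proof -
  have "\<exists>!f. f \<in> hypermap_automorphisms regular_hypermap \<and> f d = d'"
    if d: "d < order G" "d' < order G" for d d'
  proof (rule ex_ex1I)
    \<comment> \<open>Right multiplications commute with left ones; this factor is the one that
      takes \<open>d\<close> to \<open>d'\<close>.\<close>
    define h where "h = inv num d \<otimes> num d'"
    have h: "h \<in> carrier G" using d by (simp add: h_def)
    let ?f = "\<lambda>c\<in>{..<order G}. code (num c \<otimes> h)"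
    have "bij_betw ?f {..<order G} {..<order G}"
      by (rule bij_betw_byWitness[of _ "\<lambda>c\<in>{..<order G}. code (num c \<otimes> inv h)"])
        (use h in \<open>auto simp: m_assoc\<close>)
    then have "?f \<in> hypermap_automorphisms regular_hypermap"
      using h by (auto simp: hypermap_automorphisms_def Bij_def m_assoc)
    moreover have "?f d = d'" using d by (simp add: h_def m_assoc[symmetric])
    ultimately show "\<exists>f. f \<in> hypermap_automorphisms regular_hypermap \<and> f d = d'" by blast
  next
    fix f f'
    assume f: "f \<in> hypermap_automorphisms regular_hypermap \<and> f d = d'"
      and f': "f' \<in> hypermap_automorphisms regular_hypermap \<and> f' d = d'"
    show "f = f'"
    proof (rule extensionalityI)
      show "f \<in> extensional {..<order G}" "f' \<in> extensional {..<order G}"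
        using f f' by (auto simp: hypermap_automorphisms_def Bij_def)
      fix c assume "c \<in> {..<order G}"
      \<comment> \<open>Translations are transitive on darts and commute with automorphisms, so the
        value at \<open>d\<close> determines the value at every \<open>c\<close>.\<close>
      then have c: "left_mult (num c \<otimes> inv num d) d = c" "num c \<otimes> inv num d \<in> carrier G"
        using d by (auto simp: m_assoc)
      have "f (left_mult (num c \<otimes> inv num d) d) = f' (left_mult (num c \<otimes> inv num d) d)"
        using automorphism_commutes[of f _ d] automorphism_commutes[of f' _ d] f f' c(2) d by simp
      then show "f c = f' c" by (simp only: c(1))
    qed
  qed
  then show ?thesis by (simp add: orientably_regular_def is_hypermap)
qed

text \<open>The left cosets of the kernel are the fibres of \<open>ev True\<close>, and translating
  by \<open>a\<close> carries the fibre over \<open>g\<close> to the one over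
  \<open>ev True a \<otimes> g\<close>. Sending a dart \<open>d\<close> to the fibre over
  \<open>num d\<close> is thus an isomorphism.\<close>

lemma hypermap_subgroup: "is_hypermap_subgroup regular_hypermap (kernel Delta_plus G (ev True))"
proof -
  interpret D: group Delta_plus by (rule group_Delta_plus)
  interpret e: group_hom Delta_plus G "ev True" by (rule ev_group_hom)
  let ?H = "kernel Delta_plus G (ev True)"
  let ?fib = "\<lambda>g. {a \<in> carrier Delta_plus. ev True a = g}"
  have coset: "a <#\<^bsub>Delta_plus\<^esub> ?fib g = ?fib (ev True a \<otimes> g)"
    if a: "a \<in> carrier Delta_plus" and g: "g \<in> carrier G" for a g
  proof
    show "?fib (ev True a \<otimes> g) \<subseteq> a <#\<^bsub>Delta_plus\<^esub> ?fib g"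
    proof
      fix b assume b: "b \<in> ?fib (ev True a \<otimes> g)"
      then have "b = a \<otimes>\<^bsub>Delta_plus\<^esub> (inv\<^bsub>Delta_plus\<^esub> a \<otimes>\<^bsub>Delta_plus\<^esub> b)"
        using a by (simp add: D.m_assoc[symmetric])
      moreover have "inv\<^bsub>Delta_plus\<^esub> a \<otimes>\<^bsub>Delta_plus\<^esub> b \<in> ?fib g"
        using a b g by (simp add: m_assoc[symmetric])
      ultimately show "b \<in> a <#\<^bsub>Delta_plus\<^esub> ?fib g" unfolding l_coset_def by blast
    qed
  qed (use a in \<open>auto simp: l_coset_def\<close>)
  have ker: "?H = ?fib \<one>" by (auto simp: kernel_def)
  have surj: "ev True ` carrier Delta_plus = carrier G"
    using lift by (force simp: image_iff)
  have lcos: "lcosets\<^bsub>Delta_plus\<^esub> ?H = ?fib ` carrier G"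
    unfolding LCOSETS_def ker surj[symmetric] image_image by (auto simp: coset)
  have inj: "inj_on ?fib (carrier G)"
  proof (rule inj_onI)
    fix g h assume g: "g \<in> carrier G" and h: "h \<in> carrier G" and eq: "?fib g = ?fib h"
    obtain d where "d \<in> ?fib g" using lift[OF g] by auto
    with eq show "g = h" by auto
  qed
  have "hypermap_iso regular_hypermap (coset_hypermap ?H)"
    unfolding hypermap_iso_def
  proof (intro exI conjI ballI)
    have "bij_betw ?fib (carrier G) (lcosets\<^bsub>Delta_plus\<^esub> ?H)"
      using inj by (simp add: bij_betw_def lcos)
    with bij_num have "bij_betw (?fib \<circ> num) {..<order G} (lcosets\<^bsub>Delta_plus\<^esub> ?H)"
      by (rule bij_betw_trans)
    then show "bij_betw (?fib \<circ> num) (darts regular_hypermap) (darts (coset_hypermap ?H))"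
      by (simp add: coset_hypermap_def)
  qed (auto simp: coset_hypermap_def lcos coset ev_rho ev_lam)
  moreover have "finite (lcosets\<^bsub>Delta_plus\<^esub> ?H)" using finite_carrier by (simp add: lcos)
  ultimately show ?thesis by (simp add: is_hypermap_subgroup_def e.normal_kernel)
qed

lemma totally_chiral_regular_hypermap: "totally_chiral regular_hypermap"
  unfolding totally_chiral_def
  using orientably_regular hypermap_subgroup ev_kernel_product reflect_kernel by metis

end

section \<open>Three-cycles\<close>

lemma cycle_of_three_rotate:
  assumes "distinct [a, b, c]" shows "cycle_of_list [b, c, a] = cycle_of_list [a, b, c]"
  using assms by (auto simp: fun_eq_iff transpose_def)

lemma inv_cycle_of_three:
  assumes "distinct [a, b, c]" shows "inv' (cycle_of_list [a, b, c]) = cycle_of_list [a, c, b]"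
  by (rule inv_unique_comp) (use assms in \<open>auto simp: fun_eq_iff transpose_def\<close>)

lemma cycle_of_three_comp:
  assumes "distinct [a, b, c, d]"
  shows "cycle_of_list [a, b, c] \<circ> cycle_of_list [a, c, d] = cycle_of_list [c, d, b]"
  using assms by (auto simp: fun_eq_iff transpose_def)

section \<open>Three-cycles in the first factor of a subgroup of pairs\<close>

locale alt_pairs =
  fixes n :: nat and Q :: "((nat \<Rightarrow> nat) \<times> (nat \<Rightarrow> nat)) set"
  assumes subgroup_Q: "subgroup Q (alt_group n \<times>\<times> alt_group n)"
begin

lemma Q_carrier: "(g, h) \<in> Q \<Longrightarrow> g \<in> carrier (alt_group n) \<and> h \<in> carrier (alt_group n)"
  using subgroup.subset[OF subgroup_Q] by auto

lemma Q_bij: "(g, h) \<in> Q \<Longrightarrow> bij g \<and> bij h"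
  using Q_carrier[of g h] by (auto simp: alt_group_carrier intro: permutes_bij)

lemma Q_mult: "(g, h) \<in> Q \<Longrightarrow> (g', h') \<in> Q \<Longrightarrow> (g \<circ> g', h \<circ> h') \<in> Q"
  using subgroup.m_closed[OF subgroup_Q, of "(g, h)" "(g', h')"] by (simp add: alt_group_mult)

lemma Q_inv: "(g, h) \<in> Q \<Longrightarrow> (inv' g, inv' h) \<in> Q"
  using subgroup.m_inv_closed[OF subgroup_Q, of "(g, h)"] Q_carrier[of g h]
  by (simp add: inv_DirProd alt_group_is_group alt_group_inv_equality)

lemma Q_conj:
  assumes "(g, h) \<in> Q" "(c, d) \<in> Q" shows "(g \<circ> c \<circ> inv' g, h \<circ> d \<circ> inv' h) \<in> Q"
  by (intro Q_mult Q_inv assms)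

definition tri :: "nat \<Rightarrow> nat \<Rightarrow> nat \<Rightarrow> bool" where
  "tri a b c \<longleftrightarrow> distinct [a, b, c] \<and> (cycle_of_list [a, b, c], id) \<in> Q"

lemma tri_rotate: "tri a b c \<Longrightarrow> tri b c a"
  using cycle_of_three_rotate[of a b c] by (auto simp: tri_def)

lemma tri_swap: "tri a b c \<Longrightarrow> tri a c b"
  using inv_cycle_of_three[of a b c] Q_inv[of "cycle_of_list [a, b, c]" id] by (auto simp: tri_def)

text \<open>Conjugating by a pair of \<open>Q\<close> keeps the trivial second coordinate trivial
  and relabels the cycle in the first by \<open>g\<close>.\<close>

lemma tri_conj:
  assumes "(g, h) \<in> Q" "tri a b c" shows "tri (g a) (g b) (g c)"
proof -
  have bij: "bij g" "bij h" using Q_bij assms(1) by auto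
  then have "h \<circ> id \<circ> inv' h = id" by (simp add: bij_is_surj surj_iff[symmetric])
  then show ?thesis
    using Q_conj[OF assms(1), of "cycle_of_list [a, b, c]" id] assms(2) bij
      conjugation_of_cycle[of "[a, b, c]" g]
    by (auto simp: tri_def bij_is_inj inj_eq simp del: cycle_of_list.simps)
qed

text \<open>Two 3-cycles with two common points generate the alternating group on their four points.
  Concretely, conjugating \<open>(a b c)\<close> by \<open>(a b d)\<close> gives
  \<open>(b d c)\<close>; exchanging \<open>a\<close> and \<open>b\<close> gives the other
  triple.\<close>

lemma tri_four:
  assumes "tri a b c" "tri a b d" "c \<noteq> d" shows "tri a c d" "tri b c d"
proof -
  have *: "tri b d c" if "tri a b c" "tri a b d" for a b
  proof -
    have "(cycle_of_list [a, b, d], id) \<in> Q" "distinct [a, b, d]" "distinct [a, b, c]"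
      using that by (auto simp: tri_def)
    then show ?thesis
      using tri_conj[OF _ that(1), of "cycle_of_list [a, b, d]" id] assms(3)
      by (auto simp: transpose_def dest: tri_rotate)
  qed
  show "tri b c d" using *[OF assms(1,2)] by (rule tri_swap)
  show "tri a c d"
    using *[of b a] assms(1,2) by (blast intro: tri_rotate tri_swap)
qed

definition full :: "nat set \<Rightarrow> bool" where
  "full S \<longleftrightarrow> (\<forall>a\<in>S. \<forall>b\<in>S. \<forall>c\<in>S. distinct [a, b, c] \<longrightarrow> tri a b c)"

lemma full_triple: "tri a b c \<Longrightarrow> full {a, b, c}"
  by (auto simp: full_def dest: tri_rotate tri_swap)

text \<open>One 3-cycle through two old points and \<open>c\<close> suffices:
  \<open>tri_four\<close> first replaces \<open>b\<close> by any other old point, then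
  \<open>a\<close> as well.\<close>

lemma full_insert:
  assumes S: "full S" and ab: "a \<in> S" "b \<in> S" and abc: "tri a b c"
  shows "full (insert c S)"
proof (cases "c \<in> S")
  case False
  have ab': "a \<noteq> b" using abc by (simp add: tri_def)
  have one: "tri a i c" if "i \<in> S" "i \<noteq> a" for i
  proof (cases "i = b")
    case False
    then have "tri a b i" using S ab ab' that by (auto simp: full_def)
    then show ?thesis using tri_four(1)[OF _ abc] that \<open>c \<notin> S\<close> by blast
  qed (use abc in simp)
  have two: "tri i j c" if "i \<in> S" "j \<in> S" "i \<noteq> j" for i j
  proof -
    consider "i = a" | "j = a" | "i \<noteq> a" "j \<noteq> a" by blast
    then show ?thesis
    proof cases
      case 3
      then have "tri a i j" using S ab that by (auto simp: full_def)
      then show ?thesis using tri_four(2)[OF _ one[OF that(1)]] 3 that \<open>c \<notin> S\<close> by blast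
    qed (use that one[of i] one[of j] in \<open>blast dest: tri_rotate tri_swap\<close>)+
  qed
  show ?thesis
    unfolding full_def
  proof (intro ballI impI)
    fix i j k assume *: "i \<in> insert c S" "j \<in> insert c S" "k \<in> insert c S" "distinct [i, j, k]"
    consider "i = c" | "j = c" | "k = c" | "i \<in> S" "j \<in> S" "k \<in> S" using * by blast
    then show "tri i j k"
    proof cases
      case 1
      then have "tri j k c" using * two by auto
      then show ?thesis using 1 tri_rotate by blast
    next
      case 2
      then have "tri k i c" using * two by auto
      then show ?thesis using 2 tri_rotate by blast
    next
      case 3
      then show ?thesis using * two by auto
    next
      case 4
      then show ?thesis using * S by (auto simp: full_def)
    qed
  qed
qed (use S in \<open>simp add: insert_absorb\<close>)

text \<open>The 3-cycles generate the alternating group.\<close>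

lemma full_all:
  assumes "full {1..n}" "c \<in> carrier (alt_group n)"
  shows "(c, id) \<in> Q"
proof -
  have "c \<in> generate (alt_group n) (three_cycles n)"
    using assms(2) alt_group_carrier_as_three_cycles by simp
  moreover have three: "(h, id) \<in> Q" if h: "h \<in> three_cycles n" for h
  proof -
    obtain cs where cs: "h = cycle_of_list cs" "cycle cs" "length cs = 3" "set cs \<subseteq> {1..n}"
      using h by auto
    then obtain a b c where "cs = [a, b, c]" using stupid_lemma by blast
    with cs assms(1) show ?thesis
      by (auto simp: full_def tri_def simp del: cycle_of_list.simps)
  qed
  ultimately show ?thesis
  proof (induction rule: generate.induct)
    case one
    show ?case using subgroup.one_closed[OF subgroup_Q] unfolding one_DirProd alt_group_one .
  next
    case (inv h)
    then have "h \<in> carrier (alt_group n)" using three_cycles_incl by blast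
    then show ?case
      using Q_inv[OF three[OF inv(1)]] by (simp only: alt_group_inv_equality inv_id)
  next
    case (eng h1 h2)
    then show ?case using Q_mult[of h1 id h2 id] by (simp only: alt_group_mult id_comp)
  qed
qed

end

section \<open>The generating pair for the alternating group\<close>

locale odd_cycle =
  fixes n m :: nat
  assumes m: "odd m" "7 \<le> m" "n = m \<or> n = Suc m"
begin

definition x :: "nat \<Rightarrow> nat" where "x = cycle_of_list [1..<Suc m]"
definition t :: "nat \<Rightarrow> nat" where "t = cycle_of_list [2, 3, 5]"
definition s :: "nat \<Rightarrow> nat" where "s = transpose 4 6 \<circ> transpose 1 n"
definition y :: "nat \<Rightarrow> nat" where "y = t \<circ> s"

definition Q :: "((nat \<Rightarrow> nat) \<times> (nat \<Rightarrow> nat)) set" where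
  "Q = generate (alt_group n \<times>\<times> alt_group n) {(x, inv' x), (y, inv' y)}"

lemma x_values:
  "1 \<le> i \<Longrightarrow> i < m \<Longrightarrow> x i = Suc i" "x m = 1" "m < i \<Longrightarrow> x i = i"
proof -
  have map: "map x [1..<Suc m] = rotate1 [1..<Suc m]"
    using cyclic_rotation[of "[1..<Suc m]" 1] by (simp add: x_def)
  \<comment> \<open>Position \<open>k\<close> of the list holds \<open>Suc k\<close>, and the
    rotated list has there the entry at \<open>Suc k mod m\<close>.\<close>
  have *: "x (Suc k) = [1..<Suc m] ! (Suc k mod m)" if "k < m" for k
  proof -
    from map have "map x [1..<Suc m] ! k = rotate1 [1..<Suc m] ! k" by simp
    then show ?thesis using that by (simp add: nth_rotate1 del: upt_Suc)
  qed
  show "x i = Suc i" if "1 \<le> i" "i < m" using *[of "i - 1"] that by (simp del: upt_Suc)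
  show "x m = 1" using *[of "m - 1"] m by (simp del: upt_Suc)
  show "x i = i" if "m < i" using that unfolding x_def by (intro id_outside_supp) auto
qed

lemma x_closed: "x \<in> carrier (alt_group n)"
proof -
  \<comment> \<open>An \<open>m\<close>-cycle is a product of \<open>m - 1\<close> transpositions,
    an even number because \<open>m\<close> is odd.\<close>
  have "swapidseq (m - 1) x"
    using swapidseq_ext_imp_swapidseq[OF swapidseq_ext_of_cycles[of "[1..<Suc m]"]]
    by (simp add: x_def del: upt_Suc)
  then have "evenperm x = even (m - 1)" by (rule evenperm_unique) simp
  then have "evenperm x" using m by simp
  moreover have "x permutes {1..n}"
    unfolding x_def using m by (intro permutes_subset[OF cycle_permutes]) auto
  ultimately show ?thesis by (simp add: alt_group_carrier)
qed

lemma t_closed: "t \<in> carrier (alt_group n)"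
proof -
  have "t \<in> three_cycles n" using m unfolding t_def by (intro CollectI exI[of _ "[2, 3, 5]"]) auto
  then show ?thesis using three_cycles_incl by blast
qed

lemma s_closed: "s \<in> carrier (alt_group n)"
  using m by (auto simp: alt_group_carrier s_def evenperm_comp permutation_swap_id evenperm_swap
      intro!: permutes_compose permutes_swap_id)

lemma t_values: "t 2 = 3" "t 3 = 5" "t 5 = 2" "i \<notin> {2, 3, 5} \<Longrightarrow> t i = i"
  by (auto simp: t_def transpose_def)

lemma s_values: "s 4 = 6" "s 6 = 4" "s 1 = n" "s n = 1" "i \<notin> {1, 4, 6, n} \<Longrightarrow> s i = i"
  using m by (auto simp: s_def transpose_def)

lemma bij: "bij x" "bij t" "bij s"
  using x_closed t_closed s_closed by (auto simp: alt_group_carrier permutes_bij)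

lemma t_s_commute: "t \<circ> s = s \<circ> t"
  using m by (auto simp: t_def s_def fun_eq_iff transpose_def)

lemma t_t: "t \<circ> t = inv' t"
  unfolding t_def by (subst inv_cycle_of_three) (auto simp: fun_eq_iff transpose_def)

lemma s_s: "s \<circ> s = id"
  using m by (auto simp: s_def fun_eq_iff transpose_def)

lemma inv_s: "inv' s = s"
  by (rule inv_unique_comp) (simp_all add: s_s)

lemma y_closed: "y \<in> carrier (alt_group n)"
  using monoid.m_closed[OF group.is_monoid[OF alt_group_is_group] t_closed s_closed]
  by (simp add: y_def alt_group_mult)

sublocale alt_pairs n Q
proof (rule alt_pairs.intro)
  interpret P: group "alt_group n \<times>\<times> alt_group n"
    by (simp add: DirProd_group alt_group_is_group)
  show "subgroup Q (alt_group n \<times>\<times> alt_group n)"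
    unfolding Q_def using x_closed y_closed
    by (intro P.generate_is_subgroup) (auto simp: alt_group_inv_closed)
qed

lemma x_Q: "(x, inv' x) \<in> Q" and y_Q: "(t \<circ> s, inv' (t \<circ> s)) \<in> Q"
  by (auto simp: Q_def y_def intro: generate.incl)

lemma t_cube: "t \<circ> t \<circ> t = id"
  using bij(2) by (simp add: t_t bij_is_inj)

lemma t_Q: "(t, inv' t) \<in> Q"
proof -
  \<comment> \<open>Inversion reverses products, but it respects squares, so pairs
    \<open>(g, inv' g)\<close> can be squared. Two squarings reach the fourth power of
    \<open>y\<close>.\<close>
  have sq: "(g \<circ> g, inv' (g \<circ> g)) \<in> Q" if "(g, inv' g) \<in> Q" for g
    using Q_mult[OF that that] Q_bij[OF that] by (simp add: o_inv_distrib)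
  have "(t \<circ> s) \<circ> (t \<circ> s) = (t \<circ> t) \<circ> (s \<circ> s)"
    using t_s_commute by (metis comp_assoc)
  then have "((t \<circ> s) \<circ> (t \<circ> s)) \<circ> ((t \<circ> s) \<circ> (t \<circ> s)) = (t \<circ> t \<circ> t) \<circ> t"
    by (simp add: s_s comp_assoc)
  then show ?thesis using sq[OF sq[OF y_Q]] by (simp add: t_cube)
qed

text \<open>Here \<open>s\<close> arises as \<open>inv' t \<circ> y\<close>. The second coordinate
  is again \<open>s\<close>, because \<open>s\<close> is an involution commuting with
  \<open>t\<close>.\<close>

lemma s_Q: "(s, s) \<in> Q"
proof -
  have "inv' t \<circ> (t \<circ> s) = s" using bij(2) by (simp add: comp_assoc[symmetric] bij_is_inj)
  moreover have "t \<circ> inv' (t \<circ> s) = s"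
  proof -
    have "inv' (t \<circ> s) = inv' t \<circ> s"
      using bij by (simp add: t_s_commute o_inv_distrib inv_s)
    then show ?thesis using bij(2) by (metis comp_assoc bij_is_surj surj_iff id_comp)
  qed
  ultimately show ?thesis
    using Q_mult[OF Q_inv[OF t_Q] y_Q] bij(2) by (simp add: inv_inv_eq)
qed

lemma tri_357: "tri 3 5 7"
proof -
  define u v where "u = x \<circ> s \<circ> inv' x" and "v = inv' x \<circ> s \<circ> x"
  have uv: "(u, v) \<in> Q"
    using Q_conj[OF x_Q s_Q] bij by (simp add: u_def v_def inv_inv_eq)
  have xi: "x (inv' x i) = i" "inv' x (x i) = i" for i
    using bij by (simp_all add: bij_is_surj surj_f_inv_f bij_is_inj)
  have xv: "x 1 = 2" "x 2 = 3" "x 3 = 4" "x 4 = 5" "x 5 = 6" "x 6 = 7"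
    using m by (simp_all add: x_values)
  \<comment> \<open>The value \<open>x n\<close> is \<open>1\<close> if \<open>n = m\<close> and
    \<open>n\<close> otherwise; only its avoiding these four points matters.\<close>
  have xn: "x n \<notin> {2, 3, 5, 7}" using m x_values(2) x_values(3)[of n] by auto
  have "u 2 = x n" "u 3 = 3" "u 5 = 7"
    using xi(2)[of 1] xi(2)[of 2] xi(2)[of 4] xv s_values m by (auto simp: u_def)
  moreover have "v 2 = 2" "v 3 = 5" "v 5 = 3"
    using xi(2)[of 3] xi(2)[of 5] xi(2)[of 2] xv s_values m by (auto simp: v_def)
  moreover have "bij u" "bij v" using Q_bij[OF uv] by auto
  ultimately have u: "u \<circ> t \<circ> inv' u = cycle_of_list [x n, 3, 7]"
    and v: "v \<circ> t \<circ> inv' v = inv' t"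
    using conjugation_of_cycle[of "[2, 3, 5]" u] conjugation_of_cycle[of "[2, 3, 5]" v]
      inv_cycle_of_three[of 2 3 "5 :: nat"]
    by (simp_all add: t_def del: cycle_of_list.simps)
  have "v \<circ> inv' t \<circ> inv' v = t"
  proof -
    have "inv' (v \<circ> t \<circ> inv' v) = v \<circ> inv' t \<circ> inv' v"
      using \<open>bij v\<close> bij(2) by (simp add: o_inv_distrib bij_comp bij_imp_bij_inv inv_inv_eq comp_assoc)
    then show ?thesis using bij(2) by (simp add: v inv_inv_eq)
  qed
  then have c: "(cycle_of_list [x n, 3, 7], t) \<in> Q"
    using Q_conj[OF uv t_Q] u by simp
  \<comment> \<open>The commutator of \<open>(t, inv' t)\<close> with the pair just found: its
    second coordinate vanishes since \<open>inv' t\<close> and \<open>t\<close> commute, and its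
    first is a product of two 3-cycles sharing \<open>x n\<close> and \<open>7\<close>.\<close>
  have "t \<circ> cycle_of_list [x n, 3, 7] \<circ> inv' t = cycle_of_list [x n, 5, 7]"
    using conjugation_of_cycle[of "[x n, 3, 7]" t] xn bij t_values
    by (simp del: cycle_of_list.simps)
  moreover have "inv' t \<circ> t \<circ> inv' (inv' t) \<circ> inv' t = id"
    using bij(2) by (simp add: inv_inv_eq bij_is_inj bij_is_surj surj_iff[symmetric])
  moreover have "inv' (cycle_of_list [x n, 3, 7]) = cycle_of_list [x n, 7, 3]"
    using xn by (intro inv_cycle_of_three) auto
  moreover have "cycle_of_list [x n, 5, 7] \<circ> cycle_of_list [x n, 7, 3] = cycle_of_list [7, 3, 5]"
    using xn by (intro cycle_of_three_comp) auto
  ultimately have "(cycle_of_list [7, 3, 5], id) \<in> Q"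
    using Q_mult[OF Q_conj[OF t_Q c] Q_inv[OF c]] by (simp del: cycle_of_list.simps)
  then have "tri 7 3 5" by (simp add: tri_def del: cycle_of_list.simps)
  then show ?thesis by (rule tri_rotate)
qed

text \<open>Conjugation by \<open>t\<close> turns \<open>(3 5 7)\<close> into
  \<open>(5 2 7)\<close>; both contain \<open>5\<close> and \<open>7\<close>, so
  \<open>tri_four\<close> applies.\<close>

lemma tri_235: "tri 2 3 5"
proof -
  have "tri 5 2 7" using tri_conj[OF t_Q tri_357] by (simp add: t_values)
  then have "tri 5 7 2" by (rule tri_swap)
  moreover have "tri 5 7 3" using tri_357 by (rule tri_rotate)
  ultimately have "tri 5 2 3" by (rule tri_four(1)) simp
  then show ?thesis by (rule tri_rotate)
qed

text \<open>Conjugation by \<open>x\<close> translates \<open>(2 3 5)\<close> along the cycle, and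
  its inverse supplies \<open>i = 1\<close>. The bound on \<open>i + 3\<close> excludes wrapping
  around at \<open>m\<close>.\<close>

lemma tri_shift:
  assumes "1 \<le> i" "i + 3 \<le> m" "j = i + 1" "k = i + 3" shows "tri i j k"
  using assms
proof (induction i arbitrary: j k rule: dec_induct)
  case base
  have "x 1 = 2" "x 2 = 3" "x 4 = 5" using m by (simp_all add: x_values)
  then have "inv' x 2 = 1" "inv' x 3 = 2" "inv' x 5 = 4"
    using bij(1) by (metis bij_is_inj inv_f_f)+
  then show ?case using tri_conj[OF Q_inv[OF x_Q] tri_235] base by (simp add: numeral_2_eq_2)
next
  case (step i)
  then show ?case using tri_conj[OF x_Q, of i "i + 1" "i + 3"] by (simp add: x_values eval_nat_numeral)
qed

lemma full_cycle_points: "full {1..n}"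
proof -
  \<comment> \<open>Starting from \<open>{3, 5, 7}\<close>, the points 2, 4, 6, 1 are added in this
    order, so that each triple used has two points already present.\<close>
  have 346: "tri 3 4 6" and 124: "tri 1 2 4" and 457: "tri 4 5 7"
    by (rule tri_shift; use m in simp)+
  have "full {3, 5, 7}" by (rule full_triple[OF tri_357])
  then have "full (insert 2 {3, 5, 7})"
    by (rule full_insert[OF _ _ _ tri_rotate[OF tri_235]]) auto
  then have "full (insert 4 (insert 2 {3, 5, 7}))"
    by (rule full_insert[OF _ _ _ tri_rotate[OF 457]]) auto
  then have "full (insert 6 (insert 4 (insert 2 {3, 5, 7})))"
    by (rule full_insert[OF _ _ _ 346]) auto
  then have "full (insert 1 (insert 6 (insert 4 (insert 2 {3, 5, 7}))))"
    by (rule full_insert[OF _ _ _ tri_rotate[OF 124]]) auto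
  moreover have "insert 1 (insert 6 (insert 4 (insert 2 {3, 5, 7}))) = {1..7::nat}" by auto
  ultimately have 7: "full {1..7}" by simp
  have "full {1..k}" if "7 \<le> k" "k \<le> m" for k
    using that
  proof (induction k rule: dec_induct)
    case base
    show ?case by (rule 7)
  next
    case (step k)
    have "tri (k - 2) (k - 1) (Suc k)"
      by (rule tri_shift; use step(1,3,4) in linarith)
    then have "full (insert (Suc k) {1..k})"
      by (rule full_insert[rotated 3]) (use step in auto)
    then show ?case by (simp add: atLeastAtMostSuc_conv)
  qed
  then have full_m: "full {1..m}" using m by simp
  show ?thesis
  proof (cases "n = m")
    case True
    then have "{1..n} = {1..m}" by simp
    with full_m show ?thesis by (simp only:)
  next
    case False
    then have n: "n = Suc m" using m by simp
    have n7: "7 \<le> n" using m by linarith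
    \<comment> \<open>Now \<open>x\<close> fixes \<open>n\<close>, so the last point is reached by
      \<open>s\<close>, which sends \<open>1\<close> to \<open>n\<close> and fixes \<open>2\<close>
      and \<open>3\<close>.\<close>
    have "tri 1 2 3" using 7 by (simp add: full_def)
    moreover have "s 1 = n" "s 2 = 2" "s 3 = 3" using n7 by (auto simp: s_def transpose_def)
    ultimately have "tri n 2 3" using tri_conj[OF s_Q, of 1 2 3] by simp
    then have "full (insert n {1..m})"
      by (intro full_insert[OF full_m _ _ tri_rotate]) (use m in auto)
    moreover have "insert n {1..m} = {1..n}" by (auto simp: n)
    ultimately show ?thesis by simp
  qed
qed

lemma all_pairs: "c \<in> carrier (alt_group n) \<Longrightarrow> (c, id) \<in> Q"
  by (rule full_all[OF full_cycle_points])

end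

section \<open>Totally chiral hypermaps with alternating monodromy group\<close>

theorem theorem13:
  fixes n :: nat
  assumes "n \<ge> 7"
  shows "\<exists>M :: nat hypermap. totally_chiral M \<and> monodromy_group M \<cong> alt_group n"
proof -
  define m where "m = (if odd n then n else n - 1)"
  have "odd_cycle n m"
  proof
    show "odd m" "n = m \<or> n = Suc m" using assms by (auto simp: m_def)
    \<comment> \<open>For \<open>n = 7\<close> the odd choice is \<open>n\<close> itself; otherwise
      \<open>n - 1\<close> is still at least 7.\<close>
    show "7 \<le> m" using assms by (cases "n = 7") (auto simp: m_def)
  qed
  then interpret C: odd_cycle n m .
  interpret G: group "alt_group n" by (rule alt_group_is_group)
  interpret M: chiral_pair "alt_group n" C.x C.y
  proof unfold_locales
    show "finite (carrier (alt_group n))"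
      by (rule finite_subset[OF _ finite_permutations[of "{1..n}"]]) (auto simp: alt_group_carrier)
    show "(c, \<one>\<^bsub>alt_group n\<^esub>) \<in> generate (alt_group n \<times>\<times> alt_group n)
        {(C.x, inv\<^bsub>alt_group n\<^esub> C.x), (C.y, inv\<^bsub>alt_group n\<^esub> C.y)}"
      if "c \<in> carrier (alt_group n)" for c
      using C.all_pairs[OF that] C.x_closed C.y_closed
      by (simp only: C.Q_def alt_group_one alt_group_inv_equality)
  qed (rule C.x_closed C.y_closed)+
  show ?thesis using M.totally_chiral_regular_hypermap M.monodromy_iso by blast
qed

end
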